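(* Let $K$ be an algebraically closed field, let $F = \{f_1, \dots, f_k\} \subset K[x_1, \dots, x_n]$, and let $$\widehat{I} = \langle y_1 - z f_1,\ y_2 - z f_2,\ \dots,\ y_k - z f_k \rangle \subset K[z, x_1, \dots, x_n, y_1, \dots, y_k].$$ Let $G$ be a Gröbner basis of $\widehat{I}$ for a monomial order on $K[z, x_1, \dots, x_n, y_1, \dots, y_k]$ satisfying that every monomial in $K[z, x_1, \dots, x_n, y_1, \dots, y_k] \setminus K[x_1, \dots, x_n, y_1, \dots, y_k]$ is greater than every monomial in $K[x_1, \dots, x_n, y_1, \dots, y_k]$. If $V(F) = \emptyset$, then $G$ contains an extended final polynomial for $F$.
   Context: For $F = \{f_1, \dots, f_k\} \subset K[x_1, \dots, x_n]$, where $K$ is a field, $V(F) := \{v \in K^n \mid f_1(v) = \cdots = f_k(v) = 0\}$. The variables $z, x_1, \dots, x_n, y_1, \dots, y_k$ are independent indeterminates, with one variable $y_i$ for each $f_i$. A polynomial $p \in K[z, x_1, \dots, x_n, y_1, \dots, y_k]$ is called an extended final polynomial for $F$ if both of the following hold: 1. $p(z, x_1, \dots, x_n, z f_1, z f_2, \dots, z f_k) = 0$ (as a polynomial in $K[z, x_1, \dots, x_n]$), and 2. $p(z, x_1, \dots, x_n, 0, \dots, 0) = c z$ for some $c \in K \setminus \{0\}$. The Gröbner basis $G$ is not assumed to be reduced. *)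

theory Defs
  imports
    "HOL-Library.Poly_Mapping"
    "HOL-Computational_Algebra.Polynomial"
begin

type_synonym ('v, 'a) mpoly = "('v \<Rightarrow>\<^sub>0 nat) \<Rightarrow>\<^sub>0 'a"

definition Const :: "'a::comm_ring_1 \<Rightarrow> ('v, 'a) mpoly" where
  "Const c = Poly_Mapping.single 0 c"

definition Var :: "'v \<Rightarrow> ('v, 'a::comm_ring_1) mpoly" where
  "Var v = Poly_Mapping.single (Poly_Mapping.single v 1) 1"

definition poly_subst ::
    "('a \<Rightarrow> 'b) \<Rightarrow> ('v \<Rightarrow> 'b) \<Rightarrow> ('v, 'a::comm_ring_1) mpoly \<Rightarrow> 'b::comm_ring_1" where
  "poly_subst \<phi> g p =
     (\<Sum>m\<in>Poly_Mapping.keys p. \<phi> (Poly_Mapping.lookup p m) *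
       (\<Prod>v\<in>Poly_Mapping.keys m. g v ^ Poly_Mapping.lookup m v))"

definition poly_eval :: "('v \<Rightarrow> 'a) \<Rightarrow> ('v, 'a::comm_ring_1) mpoly \<Rightarrow> 'a" where
  "poly_eval = poly_subst (\<lambda>c. c)"

text \<open>The affine space \<open>K\<^sup>n\<close> is the function space \<open>'n \<Rightarrow> 'a\<close> with \<open>n = CARD('n)\<close>.\<close>

definition zero_locus :: "('n, 'a::comm_ring_1) mpoly set \<Rightarrow> ('n \<Rightarrow> 'a) set" where
  "zero_locus F = {v. \<forall>f\<in>F. poly_eval v f = 0}"

lemma module_times: "module ((*) :: 'r::comm_ring_1 \<Rightarrow> 'r \<Rightarrow> 'r)"
  by unfold_locales (simp_all add: algebra_simps)

text \<open>An ideal of a commutative ring is a submodule of the ring as a module over itself.\<close>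

definition ideal_generated :: "'r::comm_ring_1 set \<Rightarrow> 'r set" where
  "ideal_generated = module.span (*)"

text \<open>
  Monomials are identified with their exponent vectors, so that \<open>+\<close> is the
  multiplication of monomials. \<open>lead_monom p\<close> is meaningful only for \<open>p \<noteq> 0\<close>.
\<close>

locale monomial_order = wellorder less_eq less
  for less_eq :: "('v \<Rightarrow>\<^sub>0 nat) \<Rightarrow> ('v \<Rightarrow>\<^sub>0 nat) \<Rightarrow> bool" (infix \<open>\<preceq>\<close> 50)
    and less :: "('v \<Rightarrow>\<^sub>0 nat) \<Rightarrow> ('v \<Rightarrow>\<^sub>0 nat) \<Rightarrow> bool" (infix \<open>\<prec>\<close> 50) +
  assumes mult_mono: "s \<preceq> t \<Longrightarrow> s + u \<preceq> t + u"
begin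

definition lead_monom :: "('v, 'a::comm_ring_1) mpoly \<Rightarrow> ('v \<Rightarrow>\<^sub>0 nat)" where
  "lead_monom p = linorder.Max (\<preceq>) (Poly_Mapping.keys p)"

definition lead_term :: "('v, 'a::comm_ring_1) mpoly \<Rightarrow> ('v, 'a) mpoly" where
  "lead_term p = Poly_Mapping.single (lead_monom p) (Poly_Mapping.lookup p (lead_monom p))"

definition groebner_basis ::
    "('v, 'a::comm_ring_1) mpoly set \<Rightarrow> ('v, 'a) mpoly set \<Rightarrow> bool" where
  "groebner_basis G I \<longleftrightarrow> finite G \<and> G \<subseteq> I \<and>
     ideal_generated (lead_term ` (G - {0})) = ideal_generated (lead_term ` (I - {0}))"

end

datatype ('n, 'k) var = Z | X 'n | Y 'k

definition embed :: "('n, 'a::comm_ring_1) mpoly \<Rightarrow> (('n, 'k) var, 'a) mpoly" where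
  "embed = poly_subst Const (\<lambda>j. Var (X j))"

definition ideal_hat ::
    "('k \<Rightarrow> ('n, 'a::comm_ring_1) mpoly) \<Rightarrow> (('n, 'k) var, 'a) mpoly set" where
  "ideal_hat f = ideal_generated (range (\<lambda>i. Var (Y i) - Var Z * embed (f i)))"

text \<open>
  The results of the two substitutions lie in the subring \<open>K[z, x\<^sub>1, \<dots>, x\<^sub>n]\<close> of
  \<open>K[z, x\<^sub>1, \<dots>, x\<^sub>n, y\<^sub>1, \<dots>, y\<^sub>k]\<close> and are compared there.
\<close>

primrec subst_zf ::
    "('k \<Rightarrow> ('n, 'a::comm_ring_1) mpoly) \<Rightarrow> ('n, 'k) var \<Rightarrow> (('n, 'k) var, 'a) mpoly" where
  "subst_zf f Z = Var Z"
| "subst_zf f (X j) = Var (X j)"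
| "subst_zf f (Y i) = Var Z * embed (f i)"

primrec subst_0 :: "('n, 'k) var \<Rightarrow> (('n, 'k) var, 'a::comm_ring_1) mpoly" where
  "subst_0 Z = Var Z"
| "subst_0 (X j) = Var (X j)"
| "subst_0 (Y i) = 0"

definition extended_final_polynomial ::
    "('k \<Rightarrow> ('n, 'a::comm_ring_1) mpoly) \<Rightarrow> (('n, 'k) var, 'a) mpoly \<Rightarrow> bool" where
  "extended_final_polynomial f p \<longleftrightarrow>
     poly_subst Const (subst_zf f) p = 0 \<and>
     (\<exists>c. c \<noteq> 0 \<and> poly_subst Const subst_0 p = Const c * Var Z)"

end

theory Submission
  imports Defs
begin

text \<open>
  By the weak Nullstellensatz, \<open>V(F) = \<emptyset>\<close> yields \<open>1 = \<Sum> a\<^sub>i f\<^sub>i\<close>, and multiplying by \<open>z\<close> shows that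
  \<open>z - \<Sum> a\<^sub>i y\<^sub>i\<close> lies in the ideal \<open>\<langle>y\<^sub>i - z f\<^sub>i\<rangle>\<close> (\<open>lift_to_ideal_hat\<close>). In the given elimination order its
  leading monomial is \<open>z\<close>, so some nonzero \<open>g\<close> in the Groebner basis has a leading monomial dividing \<open>z\<close>.
  The ideal vanishes under \<open>y\<^sub>i \<mapsto> z f\<^sub>i\<close>; hence \<open>g\<close> is not a constant, and its leading monomial is \<open>z\<close>.
  Every monomial divisible by \<open>z\<close> and different from \<open>z\<close> is larger than \<open>z\<close>, so \<open>g = c z + q(x, y)\<close> with \<open>c \<noteq> 0\<close>.
  Putting \<open>z = 0\<close> in \<open>g(z, x, z f) = 0\<close> leaves \<open>q(x, 0) = 0\<close>, that is, \<open>g(z, x, 0) = c z\<close>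
  (\<open>subst_0_eq_of_vanishing\<close>).

  The weak Nullstellensatz itself is proved by enlarging the proper ideal to a prime ideal \<open>Q\<close> and building
  a zero of \<open>Q\<close> one coordinate at a time. This needs a statement that survives the induction on the set
  of variables: for every \<open>w \<notin> Q\<close> there is a point that is a zero of the polynomials of \<open>Q\<close> in the variables
  treated so far, but not of \<open>w\<close> (\<open>prime_ideal_has_zero\<close>). The step (\<open>extend_hom\<close>) is the classical
  extension of a homomorphism into an algebraically closed field from a subring \<open>A\<close> to \<open>A[x]\<close>: for
  \<open>w \<in> A[x]\<close> outside \<open>Q\<close> there is an obstruction \<open>u \<in> A\<close> outside \<open>Q\<close> such that every homomorphism that
  vanishes on \<open>A \<inter> Q\<close> but not at \<open>u\<close> extends so as to vanish on \<open>A[x] \<inter> Q\<close> but not at \<open>w\<close>. Its proof uses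
  pseudo-division in \<open>A[X]\<close> modulo \<open>Q\<close>, so that no residue ring has to be formed.
\<close>

section \<open>Ring homomorphisms and polynomials over a subring\<close>

locale ring_homomorphism =
  fixes \<phi> :: "'r::comm_ring_1 \<Rightarrow> 's::comm_ring_1"
  assumes hom_add: "\<phi> (a + b) = \<phi> a + \<phi> b"
    and hom_mult: "\<phi> (a * b) = \<phi> a * \<phi> b"
    and hom_one: "\<phi> 1 = 1"
begin

lemma hom_zero: "\<phi> 0 = 0"
  using hom_add[of 0 0] by simp

lemma hom_uminus: "\<phi> (- a) = - \<phi> a"
  using hom_add[of a "- a"] by (simp add: hom_zero eq_neg_iff_add_eq_0 add.commute)

lemma hom_diff: "\<phi> (a - b) = \<phi> a - \<phi> b"
  using hom_add[of a "- b"] by (simp add: hom_uminus)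

lemma hom_sum: "\<phi> (sum h S) = (\<Sum>s\<in>S. \<phi> (h s))"
  by (induction S rule: infinite_finite_induct) (simp_all add: hom_zero hom_add)

lemma hom_power: "\<phi> (a ^ k) = \<phi> a ^ k"
  by (induction k) (simp_all add: hom_one hom_mult)

lemma coeff_map_poly_hom: "coeff (map_poly \<phi> p) i = \<phi> (coeff p i)"
  by (simp add: coeff_map_poly hom_zero)

lemma map_poly_hom_add: "map_poly \<phi> (p + q) = map_poly \<phi> p + map_poly \<phi> q"
  by (rule poly_eqI) (simp add: coeff_map_poly_hom hom_add)

lemma map_poly_hom_mult: "map_poly \<phi> (p * q) = map_poly \<phi> p * map_poly \<phi> q"
  by (rule poly_eqI) (simp add: coeff_map_poly_hom coeff_mult hom_sum hom_mult)

lemma map_poly_hom_diff: "map_poly \<phi> (p - q) = map_poly \<phi> p - map_poly \<phi> q"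
  by (rule poly_eqI) (simp add: coeff_map_poly_hom hom_diff)

lemma map_poly_hom_smult: "map_poly \<phi> (smult a p) = smult (\<phi> a) (map_poly \<phi> p)"
  by (rule poly_eqI) (simp add: coeff_map_poly_hom hom_mult)

lemma map_poly_hom_eq_0:
  assumes "\<And>i. \<phi> (coeff p i) = 0"
  shows "map_poly \<phi> p = 0"
  by (rule poly_eqI) (simp add: coeff_map_poly_hom assms)

lemma hom_poly: "\<phi> (poly p x) = poly (map_poly \<phi> p) (\<phi> x)"
  by (induction p) (simp_all add: hom_zero hom_add hom_mult map_poly_pCons)

end

lemma ring_homomorphism_comp:
  assumes "ring_homomorphism \<phi>" "ring_homomorphism \<psi>"
  shows "ring_homomorphism (\<lambda>p. \<psi> (\<phi> p))"
proof -
  interpret \<phi>: ring_homomorphism \<phi> by fact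
  interpret \<psi>: ring_homomorphism \<psi> by fact
  show ?thesis
    by standard (simp_all add: \<phi>.hom_add \<phi>.hom_mult \<phi>.hom_one \<psi>.hom_add \<psi>.hom_mult \<psi>.hom_one)
qed

definition polys_with_coeffs :: "'r::comm_ring_1 set \<Rightarrow> 'r poly set" where
  "polys_with_coeffs S = {p. \<forall>i. coeff p i \<in> S}"

locale subring =
  fixes A :: "'r::comm_ring_1 set"
  assumes one_closed: "1 \<in> A"
    and diff_closed: "a \<in> A \<Longrightarrow> b \<in> A \<Longrightarrow> a - b \<in> A"
    and mult_closed: "a \<in> A \<Longrightarrow> b \<in> A \<Longrightarrow> a * b \<in> A"
begin

lemma zero_closed: "0 \<in> A"
  using diff_closed[OF one_closed one_closed] by simp

lemma add_closed: "a \<in> A \<Longrightarrow> b \<in> A \<Longrightarrow> a + b \<in> A"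
  using diff_closed[of a "0 - b"] diff_closed[OF zero_closed, of b] by simp

lemma power_closed: "a \<in> A \<Longrightarrow> a ^ k \<in> A"
  by (induction k) (simp_all add: one_closed mult_closed)

lemma sum_closed: "(\<And>s. s \<in> S \<Longrightarrow> h s \<in> A) \<Longrightarrow> sum h S \<in> A"
  by (induction S rule: infinite_finite_induct) (simp_all add: zero_closed add_closed)

lemma subring_polys_with_coeffs: "subring (polys_with_coeffs A)"
proof
  show "1 \<in> polys_with_coeffs A"
    by (auto simp: polys_with_coeffs_def one_closed zero_closed coeff_1)
qed (auto simp: polys_with_coeffs_def coeff_mult intro!: diff_closed sum_closed mult_closed)

lemma monom_in_polys_with_coeffs: "a \<in> A \<Longrightarrow> monom a n \<in> polys_with_coeffs A"
  by (simp add: polys_with_coeffs_def zero_closed)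

lemma smult_in_polys_with_coeffs:
  "a \<in> A \<Longrightarrow> p \<in> polys_with_coeffs A \<Longrightarrow> smult a p \<in> polys_with_coeffs A"
  by (simp add: polys_with_coeffs_def mult_closed)

end

section \<open>Prime ideals\<close>

interpretation ideal: module "(*) :: 'r::comm_ring_1 \<Rightarrow> 'r \<Rightarrow> 'r"
  rewrites "module.span ((*) :: 'r \<Rightarrow> 'r \<Rightarrow> 'r) = ideal_generated"
  by (rule module_times) (simp add: ideal_generated_def)

(* This rule reassociates products to the left, so it would loop with mult.assoc in algebra_simps. *)
declare ideal.scale_scale [simp del]

definition prime_ideal :: "'r::comm_ring_1 set \<Rightarrow> bool" where
  "prime_ideal Q \<longleftrightarrow> ideal.subspace Q \<and> 1 \<notin> Q \<and> (\<forall>a b. a * b \<in> Q \<longrightarrow> a \<in> Q \<or> b \<in> Q)"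

lemma prime_ideal_power: "prime_ideal Q \<Longrightarrow> a \<notin> Q \<Longrightarrow> a ^ k \<notin> Q"
  by (induction k) (auto simp: prime_ideal_def)

text \<open>An ideal that is maximal among the proper ones, which Zorn's lemma provides, is prime.\<close>

lemma prime_ideal_exists:
  fixes I :: "'r::comm_ring_1 set"
  assumes I: "ideal.subspace I" "1 \<notin> I"
  obtains Q where "prime_ideal Q" "I \<subseteq> Q"
proof -
  define \<A> where "\<A> = {J. ideal.subspace J \<and> 1 \<notin> J \<and> I \<subseteq> J}"
  have "\<exists>M\<in>\<A>. \<forall>J\<in>\<A>. M \<subseteq> J \<longrightarrow> J = M"
  proof (rule subset_Zorn_nonempty)
    show "\<A> \<noteq> {}" using I by (auto simp: \<A>_def)
    fix \<C> assume C: "\<C> \<noteq> {}" "subset.chain \<A> \<C>"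
    then have sub: "ideal.subspace J" "1 \<notin> J" "I \<subseteq> J" if "J \<in> \<C>" for J
      using that by (auto simp: \<A>_def subset.chain_def)
    have "ideal.subspace (\<Union>\<C>)"
    proof (rule ideal.subspaceI)
      show "0 \<in> \<Union>\<C>" using C(1) sub(1) ideal.subspace_0 by blast
      show "c * a \<in> \<Union>\<C>" if "a \<in> \<Union>\<C>" for a c using that sub(1) ideal.subspace_scale by blast
      fix a b assume "a \<in> \<Union>\<C>" "b \<in> \<Union>\<C>"
      then obtain J J' where *: "J \<in> \<C>" "a \<in> J" "J' \<in> \<C>" "b \<in> J'" by blast
      from * have "J \<subseteq> J' \<or> J' \<subseteq> J" using C(2) by (auto simp: subset.chain_def)
      then obtain K where "K \<in> \<C>" "a \<in> K" "b \<in> K" using * by blast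
      then show "a + b \<in> \<Union>\<C>" using ideal.subspace_add[OF sub(1)] by blast
    qed
    then show "\<Union>\<C> \<in> \<A>" using sub C(1) unfolding \<A>_def by blast
  qed
  then obtain M where M_in: "M \<in> \<A>" and M_max: "\<forall>J\<in>\<A>. M \<subseteq> J \<longrightarrow> J = M" by blast
  from M_in have M: "ideal.subspace M" "1 \<notin> M" "I \<subseteq> M" by (simp_all add: \<A>_def)
  have max: "J = M" if "ideal.subspace J" "1 \<notin> J" "M \<subseteq> J" for J
    using M_max that M(3) by (simp add: \<A>_def)
  have "b \<in> M" if ab: "a * b \<in> M" and a: "a \<notin> M" for a b
  proof -
    let ?J = "ideal_generated (insert a M)"
    have "a \<in> ?J" by (rule ideal.span_base) simp
    then have "?J \<noteq> M" using a by auto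
    moreover have "M \<subseteq> ?J"
      using ideal.span_superset[of "insert a M"] by blast
    ultimately have "1 \<in> ?J"
      using max[OF ideal.subspace_span] by blast
    then obtain k where "1 - k * a \<in> ideal_generated M"
      unfolding ideal.span_insert by blast
    then have "1 - k * a \<in> M"
      by (simp only: ideal.span_eq_iff[THEN iffD2, OF M(1)])
    from ideal.subspace_add[OF M(1) ideal.subspace_scale[OF M(1) this] ideal.subspace_scale[OF M(1) ab]]
    have "b * (1 - k * a) + k * (a * b) \<in> M" .
    moreover have "b * (1 - k * a) + k * (a * b) = b" by (simp add: algebra_simps)
    ultimately show ?thesis by simp
  qed
  with M show thesis by (intro that[of M]) (auto simp: prime_ideal_def)
qed

lemma subspace_polys_with_coeffs:
  assumes "ideal.subspace Q"
  shows "ideal.subspace (polys_with_coeffs Q)"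
proof (rule ideal.subspaceI)
  show "0 \<in> polys_with_coeffs Q"
    using ideal.subspace_0[OF assms] by (simp add: polys_with_coeffs_def)
qed (auto simp: polys_with_coeffs_def coeff_mult
      intro!: ideal.subspace_add[OF assms] ideal.subspace_sum[OF assms] ideal.subspace_scale[OF assms])

section \<open>Extending a homomorphism by one element\<close>

lemma degree_diff_lead_monom:
  fixes p :: "'a::ab_group_add poly"
  assumes "p \<noteq> monom (lead_coeff p) (degree p)"
  shows "degree (p - monom (lead_coeff p) (degree p)) < degree p"
proof -
  let ?q = "p - monom (lead_coeff p) (degree p)"
  have "degree ?q \<le> degree p"
    by (intro degree_diff_le degree_monom_le) simp
  moreover have "coeff ?q (degree p) = 0" by simp
  ultimately show ?thesis
    using eq_zero_or_degree_less[of ?q "degree p"] assms by auto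
qed

text \<open>
  Modulo \<open>Q\<close> the leading coefficient of \<open>g\<close> is a nonzero element of a domain, so the leading coefficient
  of \<open>r\<close> must vanish modulo \<open>Q\<close>; the leading term of \<open>r\<close> is then removed and the argument repeated.
\<close>

lemma cancel_mod_prime:
  assumes Q: "prime_ideal Q"
    and g: "lead_coeff g \<notin> Q"
    and "g * r \<in> polys_with_coeffs Q"
  shows "r \<in> polys_with_coeffs Q"
  using assms(3)
proof (induction "degree r" arbitrary: r rule: less_induct)
  case less
  have sQ: "ideal.subspace Q" using Q by (simp add: prime_ideal_def)
  note sX = subspace_polys_with_coeffs[OF sQ]
  have "lead_coeff g * lead_coeff r \<in> Q"
    using less.prems by (metis (mono_tags, lifting) coeff_mult_degree_sum mem_Collect_eq polys_with_coeffs_def)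
  then have l: "lead_coeff r \<in> Q" using Q g by (auto simp: prime_ideal_def)
  let ?m = "monom (lead_coeff r) (degree r)"
  have m: "?m \<in> polys_with_coeffs Q"
    using l ideal.subspace_0[OF sQ] by (simp add: polys_with_coeffs_def)
  show ?case
  proof (cases "r = ?m")
    case True
    then show ?thesis using m by metis
  next
    case False
    then have "degree (r - ?m) < degree r"
      by (rule degree_diff_lead_monom)
    moreover have "g * (r - ?m) \<in> polys_with_coeffs Q"
      using ideal.subspace_diff[OF sX less.prems ideal.subspace_scale[OF sX m, of g]]
      by (simp add: right_diff_distrib)
    ultimately have "r - ?m \<in> polys_with_coeffs Q" by (rule less.hyps)
    from ideal.subspace_add[OF sX this m] show ?thesis by simp
  qed
qed

text \<open>
  Over the fraction field of \<open>A / (A \<inter> Q)\<close> the ideal \<open>H\<close> becomes principal, generated by an element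
  of least degree. Clearing denominators turns this into pseudo-division by \<open>g\<close>, with a power of the leading
  coefficient as the only denominator and with all equations read modulo \<open>Q\<close>.
\<close>

lemma (in subring) minimal_degree_generator:
  assumes Q: "prime_ideal Q"
    and HA: "H \<subseteq> polys_with_coeffs A"
    and Hdiff: "\<And>p q. p \<in> H \<Longrightarrow> q \<in> H \<Longrightarrow> p - q \<in> H"
    and Hmult: "\<And>p q. p \<in> polys_with_coeffs A \<Longrightarrow> q \<in> H \<Longrightarrow> p * q \<in> H"
    and HQ: "polys_with_coeffs A \<inter> polys_with_coeffs Q \<subseteq> H"
    and nQ: "\<not> H \<subseteq> polys_with_coeffs Q"
  shows "\<exists>g\<in>H. lead_coeff g \<notin> Q \<and> (\<forall>p\<in>H. \<exists>k. \<exists>q\<in>polys_with_coeffs A.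
    smult (lead_coeff g ^ k) p - q * g \<in> polys_with_coeffs Q)"
proof -
  have sQ: "ideal.subspace Q" using Q by (simp add: prime_ideal_def)
  note sX = subspace_polys_with_coeffs[OF sQ]
  interpret AX: subring "polys_with_coeffs A" by (rule subring_polys_with_coeffs)
  define g where "g = arg_min degree (\<lambda>p. p \<in> H - polys_with_coeffs Q)"
  obtain p0 where p0: "p0 \<in> H - polys_with_coeffs Q" using nQ by blast
  have g: "g \<in> H" "g \<notin> polys_with_coeffs Q"
    using arg_min_natI[of "\<lambda>p. p \<in> H - polys_with_coeffs Q", OF p0] by (auto simp: g_def)
  have min: "p \<in> polys_with_coeffs Q" if "p \<in> H" "degree p < degree g" for p
    using arg_min_nat_le[of "\<lambda>p. p \<in> H - polys_with_coeffs Q" p degree] that by (auto simp: g_def)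
  have gA: "coeff g i \<in> A" for i using g HA by (auto simp: polys_with_coeffs_def)
  have lead: "lead_coeff g \<notin> Q"
  proof
    let ?m = "monom (lead_coeff g) (degree g)"
    assume "lead_coeff g \<in> Q"
    then have m: "?m \<in> polys_with_coeffs Q"
      using ideal.subspace_0[OF sQ] by (simp add: polys_with_coeffs_def)
    with HQ have "?m \<in> H" using monom_in_polys_with_coeffs[OF gA] by blast
    then have H: "g - ?m \<in> H" using g Hdiff by blast
    have "degree (g - ?m) < degree g"
      using m g by (intro degree_diff_lead_monom) metis
    then have "g - ?m \<in> polys_with_coeffs Q" using min H by blast
    from ideal.subspace_add[OF sX this m] g show False by simp
  qed
  have "\<exists>k. \<exists>q\<in>polys_with_coeffs A. smult (lead_coeff g ^ k) p - q * g \<in> polys_with_coeffs Q"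
    if "p \<in> H" for p
    using that
  proof (induction "degree p" arbitrary: p rule: less_induct)
    case less
    show ?case
    proof (cases "degree p < degree g")
      case True
      then show ?thesis using min[OF less.prems]
        by (intro exI[of _ 0] bexI[of _ 0]) (simp_all add: AX.zero_closed)
    next
      case False
      \<comment> \<open>one step of pseudo-division: cross-multiplication cancels the leading coefficient\<close>
      define m where "m = monom (lead_coeff p) (degree p - degree g)"
      define p' where "p' = smult (lead_coeff g) p - m * g"
      have pA: "p \<in> polys_with_coeffs A" using less.prems HA by blast
      then have mA: "m \<in> polys_with_coeffs A"
        by (auto simp: m_def polys_with_coeffs_def zero_closed)
      have "smult (lead_coeff g) p \<in> H"
        using Hmult[OF monom_in_polys_with_coeffs[OF gA[of "degree g"], of 0] less.prems]
        by (simp add: monom_0)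
      then have p'H: "p' \<in> H" unfolding p'_def using Hdiff Hmult[OF mA] g by blast
      have "degree (m * g) \<le> degree p"
        using degree_mult_le[of m g] degree_monom_le[of "lead_coeff p" "degree p - degree g"] False
        by (simp add: m_def)
      then have dp': "degree p' \<le> degree p"
        unfolding p'_def by (rule degree_diff_le[OF degree_smult_le])
      have "coeff (m * g) (degree p) = lead_coeff p * lead_coeff g"
        using False by (simp add: m_def coeff_monom_mult)
      then have "coeff p' (degree p) = 0" by (simp add: p'_def mult.commute)
      with dp' have "p' = 0 \<or> degree p' < degree p" using eq_zero_or_degree_less by blast
      then have "\<exists>k. \<exists>q\<in>polys_with_coeffs A.
          smult (lead_coeff g ^ k) p' - q * g \<in> polys_with_coeffs Q"
      proof
        assume "p' = 0"
        then show ?thesis using ideal.subspace_0[OF sX]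
          by (intro exI[of _ 0] bexI[of _ 0]) (simp_all add: AX.zero_closed)
      qed (use less.hyps p'H in blast)
      then obtain k q where q: "q \<in> polys_with_coeffs A"
        "smult (lead_coeff g ^ k) p' - q * g \<in> polys_with_coeffs Q" by blast
      have "smult (lead_coeff g ^ k) p' - q * g =
          smult (lead_coeff g ^ Suc k) p - (q + smult (lead_coeff g ^ k) m) * g"
        by (simp add: p'_def algebra_simps smult_diff_right)
      moreover have "q + smult (lead_coeff g ^ k) m \<in> polys_with_coeffs A"
        using q mA gA by (intro AX.add_closed smult_in_polys_with_coeffs power_closed)
      ultimately show ?thesis using q(2) by metis
    qed
  qed
  with g lead show ?thesis by blast
qed

lemma poly_in_ideal:
  assumes "ideal.subspace Q" "p \<in> polys_with_coeffs Q"
  shows "poly p x \<in> Q"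
  unfolding poly_altdef
proof (rule ideal.subspace_sum[OF assms(1)])
  show "coeff p i * x ^ i \<in> Q" for i
    using ideal.subspace_scale[OF assms(1), of "coeff p i" "x ^ i"] assms(2)
    by (simp add: polys_with_coeffs_def mult.commute)
qed

lemma exists_non_root:
  fixes p :: "'a::alg_closed_field poly"
  assumes "p \<noteq> 0"
  obtains \<xi> where "poly p \<xi> \<noteq> 0"
proof -
  \<comment> \<open>a root \<open>\<xi>\<close> of \<open>1 + X p\<close> satisfies \<open>\<xi> p(\<xi>) = - 1\<close>\<close>
  have "coeff (pCons 1 p) (Suc (degree p)) \<noteq> 0" using assms by simp
  then have "degree (pCons 1 p) > 0" using le_degree by fastforce
  then obtain \<xi> where "poly (pCons 1 p) \<xi> = 0" using alg_closed_imp_poly_has_root by blast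
  then have "poly p \<xi> \<noteq> 0" by auto
  then show thesis by (rule that)
qed

text \<open>
  The assignment \<open>x \<mapsto> \<xi>\<close> extends \<open>\<phi>\<close> from \<open>A\<close> to a homomorphism on \<open>A[x]\<close> that vanishes on \<open>A[x] \<inter> Q\<close>
  but not at \<open>v(x)\<close>. Stating this through polynomials over \<open>A\<close> avoids partially defined homomorphisms.
\<close>

definition extendable ::
    "'r::comm_ring_1 set \<Rightarrow> 'r set \<Rightarrow> 'r \<Rightarrow> 'r poly \<Rightarrow> ('r \<Rightarrow> 'a::comm_ring_1) \<Rightarrow> bool" where
  "extendable A Q x v \<phi> \<longleftrightarrow> (\<exists>\<xi>.
     (\<forall>p\<in>polys_with_coeffs A. poly p x \<in> Q \<longrightarrow> poly (map_poly \<phi> p) \<xi> = 0) \<and>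
     poly (map_poly \<phi> v) \<xi> \<noteq> 0)"

text \<open>
  When \<open>x\<close> is transcendental over \<open>A\<close> modulo \<open>Q\<close>, any value \<open>\<xi>\<close> respects the relations, so \<open>\<xi>\<close> has only
  to avoid the roots of the image of \<open>v\<close>. For that image to be nonzero, it suffices that one coefficient
  of \<open>v\<close>, the obstruction \<open>u\<close>, is not mapped to zero.
\<close>

lemma (in subring) extend_hom_transcendental:
  assumes Q: "prime_ideal Q"
    and J: "\<And>p. p \<in> polys_with_coeffs A \<Longrightarrow> poly p x \<in> Q \<Longrightarrow> p \<in> polys_with_coeffs Q"
    and v: "v \<in> polys_with_coeffs A" "poly v x \<notin> Q"
  shows "\<exists>u\<in>A - Q. \<forall>\<phi> :: 'r \<Rightarrow> 'a::alg_closed_field.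
    ring_homomorphism \<phi> \<longrightarrow> \<phi> ` (A \<inter> Q) \<subseteq> {0} \<longrightarrow> \<phi> u \<noteq> 0 \<longrightarrow> extendable A Q x v \<phi>"
proof -
  have sQ: "ideal.subspace Q" using Q by (simp add: prime_ideal_def)
  have "v \<notin> polys_with_coeffs Q"
    using v poly_in_ideal[OF sQ] by blast
  then obtain i where i: "coeff v i \<notin> Q" by (auto simp: polys_with_coeffs_def)
  show ?thesis
  proof (intro bexI[of _ "coeff v i"] allI impI)
    fix \<phi> :: "'r \<Rightarrow> 'a"
    assume "ring_homomorphism \<phi>" and ker_image: "\<phi> ` (A \<inter> Q) \<subseteq> {0}"
      and "\<phi> (coeff v i) \<noteq> 0"
    then interpret ring_homomorphism \<phi> by simp
    have ker: "\<phi> q = 0" if "q \<in> A" "q \<in> Q" for q using ker_image that by blast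
    have "map_poly \<phi> v \<noteq> 0"
      using \<open>\<phi> (coeff v i) \<noteq> 0\<close> by (metis coeff_0 coeff_map_poly_hom)
    then obtain \<xi> where "poly (map_poly \<phi> v) \<xi> \<noteq> 0" by (rule exists_non_root)
    moreover have "map_poly \<phi> p = 0" if "p \<in> polys_with_coeffs A" "poly p x \<in> Q" for p
      by (rule map_poly_hom_eq_0, rule ker)
        (use J[OF that] that in \<open>simp_all add: polys_with_coeffs_def\<close>)
    ultimately show "extendable A Q x v \<phi>" by (auto simp: extendable_def)
  qed (use v i in \<open>auto simp: polys_with_coeffs_def\<close>)
qed

text \<open>
  When \<open>x\<close> is algebraic over \<open>A\<close> modulo \<open>Q\<close>, let \<open>g\<close> be its minimal polynomial up to denominators. As long
  as the leading coefficient of \<open>g\<close> survives, the roots of the image of \<open>g\<close> are roots of all relations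
  of \<open>x\<close>. Since \<open>g\<close> is irreducible and does not divide \<open>v\<close> over the fraction field, the two are coprime, and a
  Bezout identity \<open>c = s v + j\<close> with \<open>c \<in> A\<close> outside \<open>Q\<close> and \<open>j\<close> a relation of \<open>x\<close> shows that none of
  these roots is a root of \<open>v\<close> as long as \<open>c\<close> survives. The obstruction is the product of \<open>c\<close> with the
  leading coefficient of \<open>g\<close>.
\<close>

lemma (in subring) extend_hom_algebraic:
  assumes Q: "prime_ideal Q" and x: "p0 \<in> polys_with_coeffs A" "poly p0 x \<in> Q" "p0 \<notin> polys_with_coeffs Q"
    and v: "v \<in> polys_with_coeffs A" "poly v x \<notin> Q"
  shows "\<exists>u\<in>A - Q. \<forall>\<phi> :: 'r \<Rightarrow> 'a::alg_closed_field.
    ring_homomorphism \<phi> \<longrightarrow> \<phi> ` (A \<inter> Q) \<subseteq> {0} \<longrightarrow> \<phi> u \<noteq> 0 \<longrightarrow> extendable A Q x v \<phi>"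
proof -
  have sQ: "ideal.subspace Q" using Q by (simp add: prime_ideal_def)
  note sX = subspace_polys_with_coeffs[OF sQ]
  have Q_prime: "a \<in> Q \<or> b \<in> Q" if "a * b \<in> Q" for a b using Q that by (simp add: prime_ideal_def)
  have eval_Q: "poly p x \<in> Q" if "p \<in> polys_with_coeffs Q" for p
    by (rule poly_in_ideal[OF sQ that])
  interpret AX: subring "polys_with_coeffs A" by (rule subring_polys_with_coeffs)
  \<comment> \<open>the relations of \<open>x\<close> modulo \<open>Q\<close>\<close>
  define J where "J = {p \<in> polys_with_coeffs A. poly p x \<in> Q}"
  have J_diff: "p - q \<in> J" if "p \<in> J" "q \<in> J" for p q
    using that AX.diff_closed ideal.subspace_diff[OF sQ] by (auto simp: J_def)
  have J_mult: "p * q \<in> J" if "p \<in> polys_with_coeffs A" "q \<in> J" for p q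
    using that AX.mult_closed ideal.subspace_scale[OF sQ] by (auto simp: J_def)
  have J_Q: "polys_with_coeffs A \<inter> polys_with_coeffs Q \<subseteq> J"
    using eval_Q by (auto simp: J_def)
  have "J \<subseteq> polys_with_coeffs A" "\<not> J \<subseteq> polys_with_coeffs Q" using x by (auto simp: J_def)
  from minimal_degree_generator[OF Q this(1) J_diff J_mult J_Q this(2)]
  obtain g where g: "g \<in> J" "lead_coeff g \<notin> Q"
    and g_gen: "\<And>p. p \<in> J \<Longrightarrow> \<exists>k. \<exists>q\<in>polys_with_coeffs A.
       smult (lead_coeff g ^ k) p - q * g \<in> polys_with_coeffs Q" by blast
  \<comment> \<open>The generator \<open>h\<close> of the ideal spanned by \<open>v\<close> and the relations is a greatest common divisor
    of \<open>v\<close> and \<open>g\<close>; it will turn out to be a unit modulo \<open>Q\<close> up to denominators.\<close>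
  define H where "H = {s * v + j |s j. s \<in> polys_with_coeffs A \<and> j \<in> J}"
  have H_I: "s * v + j \<in> H" if "s \<in> polys_with_coeffs A" "j \<in> J" for s j
    using that unfolding H_def by blast
  have H_E: "\<exists>s\<in>polys_with_coeffs A. \<exists>j\<in>J. p = s * v + j" if "p \<in> H" for p
    using that unfolding H_def by blast
  have J_A: "j \<in> polys_with_coeffs A" if "j \<in> J" for j using that by (simp add: J_def)
  have H_A: "H \<subseteq> polys_with_coeffs A"
  proof
    fix p assume "p \<in> H"
    then obtain s j where p: "p = s * v + j" "s \<in> polys_with_coeffs A" "j \<in> J" using H_E by blast
    show "p \<in> polys_with_coeffs A"
      unfolding p(1) by (rule AX.add_closed[OF AX.mult_closed[OF p(2) v(1)] J_A[OF p(3)]])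
  qed
  have H_diff: "p - q \<in> H" if p: "p \<in> H" and q: "q \<in> H" for p q
  proof -
    obtain s j where p: "p = s * v + j" "s \<in> polys_with_coeffs A" "j \<in> J" using H_E[OF p] by blast
    obtain s' j' where q: "q = s' * v + j'" "s' \<in> polys_with_coeffs A" "j' \<in> J" using H_E[OF q] by blast
    have "p - q = (s - s') * v + (j - j')" by (simp add: p q algebra_simps)
    then show ?thesis using H_I[OF AX.diff_closed[OF p(2) q(2)] J_diff[OF p(3) q(3)]] by simp
  qed
  have H_mult: "p * q \<in> H" if p: "p \<in> polys_with_coeffs A" and q: "q \<in> H" for p q
  proof -
    obtain s j where q: "q = s * v + j" "s \<in> polys_with_coeffs A" "j \<in> J" using H_E[OF q] by blast
    have "p * q = (p * s) * v + (p * j)" unfolding q(1) by (simp add: algebra_simps)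
    then show ?thesis using H_I[OF AX.mult_closed[OF p q(2)] J_mult[OF p q(3)]] by (simp only:)
  qed
  have J_H: "j \<in> H" if "j \<in> J" for j
    using H_I[OF AX.zero_closed that] by simp
  have "0 \<in> J" using J_diff[OF g(1) g(1)] by simp
  then have v_H: "v \<in> H" using H_I[OF AX.one_closed] by fastforce
  have H_Q: "polys_with_coeffs A \<inter> polys_with_coeffs Q \<subseteq> H" using J_Q J_H by blast
  have H_nQ: "\<not> H \<subseteq> polys_with_coeffs Q" using v_H eval_Q v by blast
  obtain h where h: "h \<in> H" "lead_coeff h \<notin> Q"
    and h_gen: "\<And>p. p \<in> H \<Longrightarrow> \<exists>k. \<exists>q\<in>polys_with_coeffs A.
       smult (lead_coeff h ^ k) p - q * h \<in> polys_with_coeffs Q"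
    using minimal_degree_generator[OF Q H_A H_diff H_mult H_Q H_nQ] by blast
  have coeff_A: "coeff p i \<in> A" if "p \<in> H" for p i
    using that H_A unfolding polys_with_coeffs_def by blast
  have lead_A: "lead_coeff g \<in> A" "lead_coeff h \<in> A"
    using coeff_A J_H g(1) h(1) by blast+
  \<comment> \<open>otherwise \<open>v\<close>, a pseudo-multiple of \<open>h\<close>, would be a relation too\<close>
  have h_nJ: "poly h x \<notin> Q"
  proof
    assume "poly h x \<in> Q"
    obtain k q where "smult (lead_coeff h ^ k) v - q * h \<in> polys_with_coeffs Q"
      using h_gen[OF v_H] by blast
    then have "lead_coeff h ^ k * poly v x - poly q x * poly h x \<in> Q"
      using eval_Q by fastforce
    moreover have "poly q x * poly h x \<in> Q"
      using \<open>poly h x \<in> Q\<close> ideal.subspace_scale[OF sQ] by blast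
    ultimately have "lead_coeff h ^ k * poly v x \<in> Q"
      using ideal.subspace_add[OF sQ] by fastforce
    then show False using Q_prime v prime_ideal_power[OF Q h(2)] by blast
  qed
  \<comment> \<open>Up to denominators \<open>g = q h\<close>. Since \<open>Q\<close> is prime, \<open>q\<close> is a relation, thus \<open>q = r g\<close>, and cancelling
    \<open>g\<close> leaves \<open>1 = r h\<close>.\<close>
  obtain k q where q: "q \<in> polys_with_coeffs A"
    and gqh: "smult (lead_coeff h ^ k) g - q * h \<in> polys_with_coeffs Q"
    using h_gen[of g] g J_H by blast
  have "lead_coeff h ^ k * poly g x - poly q x * poly h x \<in> Q"
    using eval_Q[OF gqh] by simp
  moreover have "lead_coeff h ^ k * poly g x \<in> Q"
    using g ideal.subspace_scale[OF sQ] by (simp add: J_def)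
  ultimately have "poly q x * poly h x \<in> Q"
    using ideal.subspace_diff[OF sQ] by fastforce
  then have "poly q x \<in> Q" using Q_prime h_nJ by blast
  then have "q \<in> J" using q by (simp add: J_def)
  then obtain l r where r: "r \<in> polys_with_coeffs A"
    and qrg: "smult (lead_coeff g ^ l) q - r * g \<in> polys_with_coeffs Q"
    using g_gen by blast
  define c where "c = lead_coeff g ^ l * lead_coeff h ^ k"
  have c: "c \<in> A" "c \<notin> Q"
    using lead_A prime_ideal_power[OF Q g(2)] prime_ideal_power[OF Q h(2)] Q_prime
    by (auto simp: c_def intro: mult_closed power_closed)
  have "g * ([:c:] - r * h) = [:lead_coeff g ^ l:] * (smult (lead_coeff h ^ k) g - q * h)
      + h * (smult (lead_coeff g ^ l) q - r * g)"
    by (simp add: c_def algebra_simps smult_diff_right)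
  also have "\<dots> \<in> polys_with_coeffs Q"
    using gqh qrg by (intro ideal.subspace_add[OF sX] ideal.subspace_scale[OF sX])
  finally have "[:c:] - r * h \<in> polys_with_coeffs Q"
    by (rule cancel_mod_prime[OF Q g(2)])
  moreover have "[:c:] - r * h \<in> polys_with_coeffs A"
    using monom_in_polys_with_coeffs[OF c(1), of 0] r h H_A
    by (intro AX.diff_closed AX.mult_closed) (auto simp: monom_0)
  ultimately have "[:c:] - r * h \<in> H" using J_Q J_H by blast
  then have "[:c:] - r * h - (0 - r) * h \<in> H"
    using H_diff H_mult[OF AX.diff_closed[OF AX.zero_closed r] h(1)] by blast
  then have "[:c:] \<in> H" by (simp add: algebra_simps)
  then obtain s j where sj: "[:c:] = s * v + j" "s \<in> polys_with_coeffs A" "j \<in> J"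
    using H_E by blast
  show ?thesis
  proof (intro bexI[of _ "lead_coeff g * c"] allI impI)
    show "lead_coeff g * c \<in> A - Q"
      using lead_A c g Q_prime mult_closed by blast
    fix \<phi> :: "'r \<Rightarrow> 'a"
    assume "ring_homomorphism \<phi>" and ker_image: "\<phi> ` (A \<inter> Q) \<subseteq> {0}"
      and u: "\<phi> (lead_coeff g * c) \<noteq> 0"
    then interpret ring_homomorphism \<phi> by simp
    have ker: "\<phi> q = 0" if "q \<in> A" "q \<in> Q" for q using ker_image that by blast
    from u have u: "\<phi> (lead_coeff g) \<noteq> 0" "\<phi> c \<noteq> 0" by (auto simp: hom_mult)
    \<comment> \<open>a constant relation would be its own leading coefficient and lie in \<open>Q\<close>\<close>
    have "degree g > 0"
    proof (rule ccontr)
      assume "\<not> degree g > 0"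
      then obtain b where "g = [:b:]" using degree_eq_zeroE by blast
      then have "poly g x = lead_coeff g" by simp
      then show False using g by (simp add: J_def)
    qed
    moreover have "degree g \<le> degree (map_poly \<phi> g)"
      using u by (intro le_degree) (simp add: coeff_map_poly_hom)
    ultimately obtain \<xi> where \<xi>: "poly (map_poly \<phi> g) \<xi> = 0"
      using alg_closed_imp_poly_has_root by (metis less_le_trans)
    have root: "poly (map_poly \<phi> p) \<xi> = 0" if p: "p \<in> J" for p
    proof -
      obtain n t where t: "t \<in> polys_with_coeffs A"
        and pt: "smult (lead_coeff g ^ n) p - t * g \<in> polys_with_coeffs Q"
        using g_gen[OF p] by blast
      have "smult (lead_coeff g ^ n) p - t * g \<in> polys_with_coeffs A"
        using t p g lead_A
        by (intro AX.diff_closed AX.mult_closed smult_in_polys_with_coeffs power_closed)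
          (auto simp: J_def)
      with pt have "map_poly \<phi> (smult (lead_coeff g ^ n) p - t * g) = 0"
        by (intro map_poly_hom_eq_0 ker) (simp_all add: polys_with_coeffs_def)
      then have "poly (smult (\<phi> (lead_coeff g) ^ n) (map_poly \<phi> p) - map_poly \<phi> t * map_poly \<phi> g) \<xi> = 0"
        by (simp add: map_poly_hom_diff map_poly_hom_mult map_poly_hom_smult hom_power)
      then show ?thesis using u \<xi> by simp
    qed
    have "poly (map_poly \<phi> v) \<xi> \<noteq> 0"
    proof
      assume "poly (map_poly \<phi> v) \<xi> = 0"
      then have "poly (map_poly \<phi> (s * v + j)) \<xi> = 0"
        using root[OF sj(3)] by (simp add: map_poly_hom_add map_poly_hom_mult)
      then show False using u by (simp add: sj(1)[symmetric] map_poly_pCons hom_zero)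
    qed
    with root show "extendable A Q x v \<phi>" by (auto simp: extendable_def J_def)
  qed
qed

lemma (in subring) extend_hom:
  assumes Q: "prime_ideal Q"
    and v: "v \<in> polys_with_coeffs A" "poly v x \<notin> Q"
  shows "\<exists>u\<in>A - Q. \<forall>\<phi> :: 'r \<Rightarrow> 'a::alg_closed_field.
    ring_homomorphism \<phi> \<longrightarrow> \<phi> ` (A \<inter> Q) \<subseteq> {0} \<longrightarrow> \<phi> u \<noteq> 0 \<longrightarrow> extendable A Q x v \<phi>"
proof (cases "\<exists>p0\<in>polys_with_coeffs A. poly p0 x \<in> Q \<and> p0 \<notin> polys_with_coeffs Q")
  case True
  then obtain p0 where p0: "p0 \<in> polys_with_coeffs A" "poly p0 x \<in> Q" "p0 \<notin> polys_with_coeffs Q"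
    by blast
  show ?thesis by (rule extend_hom_algebraic[OF Q p0 v])
next
  case False
  then have "\<And>p. p \<in> polys_with_coeffs A \<Longrightarrow> poly p x \<in> Q \<Longrightarrow> p \<in> polys_with_coeffs Q" by blast
  then show ?thesis by (rule extend_hom_transcendental[OF Q _ v])
qed

section \<open>Substitution homomorphisms of multivariate polynomials\<close>

lemma poly_subst_superset:
  assumes "\<phi> 0 = 0" "finite S" "Poly_Mapping.keys p \<subseteq> S"
  shows "poly_subst \<phi> g p = (\<Sum>m\<in>S. \<phi> (Poly_Mapping.lookup p m) *
       (\<Prod>v\<in>Poly_Mapping.keys m. g v ^ Poly_Mapping.lookup m v))"
  unfolding poly_subst_def using assms
  by (intro sum.mono_neutral_left) (auto simp: in_keys_iff)

lemma monomial_value_superset: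
  assumes "finite S" "Poly_Mapping.keys m \<subseteq> S"
  shows "(\<Prod>v\<in>Poly_Mapping.keys m. (g v :: 'b::comm_ring_1) ^ Poly_Mapping.lookup m v) =
    (\<Prod>v\<in>S. g v ^ Poly_Mapping.lookup m v)"
  using assms by (intro prod.mono_neutral_left) (auto simp: in_keys_iff)

lemma monomial_value_add:
  "(\<Prod>v\<in>Poly_Mapping.keys (m + n). (g v :: 'b::comm_ring_1) ^ Poly_Mapping.lookup (m + n) v) =
   (\<Prod>v\<in>Poly_Mapping.keys m. g v ^ Poly_Mapping.lookup m v) *
   (\<Prod>v\<in>Poly_Mapping.keys n. g v ^ Poly_Mapping.lookup n v)"
proof -
  let ?S = "Poly_Mapping.keys m \<union> Poly_Mapping.keys n"
  show ?thesis
    using Poly_Mapping.keys_add[of m n]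
    unfolding monomial_value_superset[of ?S m, OF finite_UnI[OF finite_keys finite_keys] Un_upper1]
      monomial_value_superset[of ?S n, OF finite_UnI[OF finite_keys finite_keys] Un_upper2]
    by (subst monomial_value_superset[of ?S "m + n"])
      (simp_all add: lookup_add power_add prod.distrib)
qed

lemma poly_mapping_induct_single_add [case_names single add]:
  fixes p :: "'v \<Rightarrow>\<^sub>0 'a::comm_monoid_add"
  assumes "\<And>m c. P (Poly_Mapping.single m c)"
    and "\<And>p q. P p \<Longrightarrow> P q \<Longrightarrow> P (p + q)"
  shows "P p"
proof (induction p rule: update_induct)
  case const
  then show ?case using assms(1)[of undefined 0] by simp
next
  case (update f k c)
  have "Poly_Mapping.update k c f = Poly_Mapping.single k c + f"
    using update(1) by (intro poly_mapping_eqI)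
      (auto simp: lookup_update lookup_add lookup_single in_keys_iff when_def)
  then show ?case using assms update(3) by simp
qed

lemma (in ring_homomorphism) poly_subst_add: "poly_subst \<phi> g (p + q) = poly_subst \<phi> g p + poly_subst \<phi> g q"
proof -
  let ?S = "Poly_Mapping.keys p \<union> Poly_Mapping.keys q"
  show ?thesis
    using Poly_Mapping.keys_add[of p q]
    by (simp add: poly_subst_superset[of \<phi> ?S] hom_zero lookup_add hom_add distrib_right sum.distrib)
qed

lemma (in ring_homomorphism) poly_subst_single:
  "poly_subst \<phi> g (Poly_Mapping.single m c) =
    \<phi> c * (\<Prod>v\<in>Poly_Mapping.keys m. g v ^ Poly_Mapping.lookup m v)"
  by (subst poly_subst_superset[of \<phi> "{m}"]) (auto simp: hom_zero)

lemma (in ring_homomorphism) poly_subst_hom: "ring_homomorphism (poly_subst \<phi> g)"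
proof
  show "poly_subst \<phi> g (p + q) = poly_subst \<phi> g p + poly_subst \<phi> g q" for p q
    by (rule poly_subst_add)
  show "poly_subst \<phi> g 1 = 1"
    using poly_subst_single[of g 0 1] by (simp add: hom_one single_one)
  have single: "poly_subst \<phi> g (Poly_Mapping.single m c * q) =
      poly_subst \<phi> g (Poly_Mapping.single m c) * poly_subst \<phi> g q" for m c q
    by (induction q rule: poly_mapping_induct_single_add)
      (simp_all add: mult_single poly_subst_single monomial_value_add hom_mult
        distrib_left poly_subst_add)
  show "poly_subst \<phi> g (p * q) = poly_subst \<phi> g p * poly_subst \<phi> g q" for p q
    by (induction p rule: poly_mapping_induct_single_add) (simp_all add: single distrib_right poly_subst_add)
qed

lemma (in ring_homomorphism) poly_subst_Const: "poly_subst \<phi> g (Const c) = \<phi> c"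
  by (simp add: Const_def poly_subst_single)

lemma (in ring_homomorphism) poly_subst_Var: "poly_subst \<phi> g (Var v) = g v"
  by (simp add: Var_def poly_subst_single hom_one)

lemma ring_homomorphism_Const: "ring_homomorphism Const"
  by standard (simp_all add: Const_def single_add mult_single single_one)

lemma ring_homomorphism_id: "ring_homomorphism (\<lambda>c. c)"
  by standard simp_all

text \<open>
  The subalgebra of polynomials in the variables \<open>V\<close>, given by generators so that statements about
  homomorphisms follow by rule induction.
\<close>

inductive_set mpolys_in :: "'v set \<Rightarrow> ('v, 'a::comm_ring_1) mpoly set" for V where
  Const: "Const c \<in> mpolys_in V"
| Var: "v \<in> V \<Longrightarrow> Var v \<in> mpolys_in V"
| add: "p \<in> mpolys_in V \<Longrightarrow> q \<in> mpolys_in V \<Longrightarrow> p + q \<in> mpolys_in V"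
| mult: "p \<in> mpolys_in V \<Longrightarrow> q \<in> mpolys_in V \<Longrightarrow> p * q \<in> mpolys_in V"

lemma subring_mpolys_in: "subring (mpolys_in V :: ('v, 'a::comm_ring_1) mpoly set)"
proof
  show "1 \<in> mpolys_in V"
    using mpolys_in.Const[of 1] by (simp add: Const_def single_one)
  show "p - q \<in> mpolys_in V" if "p \<in> mpolys_in V" "q \<in> mpolys_in V" for p q :: "('v, 'a) mpoly"
  proof -
    have "p + Const (- 1) * q \<in> mpolys_in V" using that by (intro mpolys_in.intros)
    then show ?thesis by (simp add: Const_def single_uminus single_one)
  qed
qed (rule mpolys_in.mult)

lemma mpolys_in_mono: "V \<subseteq> W \<Longrightarrow> mpolys_in V \<subseteq> mpolys_in W"
  by (rule subsetI, erule mpolys_in.induct) (auto intro: mpolys_in.intros)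

lemma mpolys_in_UNIV: "(p :: ('v, 'a::comm_ring_1) mpoly) \<in> mpolys_in UNIV"
proof (induction p rule: poly_mapping_induct_single_add)
  case (single m c)
  interpret subring "mpolys_in UNIV :: ('v, 'a) mpoly set" by (rule subring_mpolys_in)
  have "(Poly_Mapping.single m 1 :: ('v, 'a) mpoly) \<in> mpolys_in UNIV"
  proof (induction m rule: poly_mapping_induct_single_add)
    case (single v k)
    have "Poly_Mapping.single (Poly_Mapping.single v k) 1 = (Var v :: ('v, 'a) mpoly) ^ k"
    proof (induction k)
      case (Suc k)
      have "Poly_Mapping.single (Poly_Mapping.single v (Suc k)) 1 =
          (Var v :: ('v, 'a) mpoly) * Poly_Mapping.single (Poly_Mapping.single v k) 1"
        by (simp add: Var_def mult_single single_add[symmetric])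
      then show ?case by (simp add: Suc)
    qed (simp add: single_one)
    then show ?case by (simp add: power_closed mpolys_in.Var)
  next
    case (add m n)
    then show ?case using mpolys_in.mult[OF add] by (simp add: mult_single)
  qed
  from mpolys_in.mult[OF mpolys_in.Const[of c] this] show ?case
    by (simp add: Const_def mult_single)
qed (rule mpolys_in.add)

lemma ring_homomorphisms_eq_on:
  assumes "ring_homomorphism \<phi>" "ring_homomorphism \<psi>" "p \<in> mpolys_in V"
    and "\<And>c. \<phi> (Const c) = \<psi> (Const c)" "\<And>v. v \<in> V \<Longrightarrow> \<phi> (Var v) = \<psi> (Var v)"
  shows "\<phi> p = \<psi> p"
proof -
  interpret \<phi>: ring_homomorphism \<phi> by fact
  interpret \<psi>: ring_homomorphism \<psi> by fact
  show ?thesis using assms(3)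
    by induction (simp_all add: assms(4,5) \<phi>.hom_add \<psi>.hom_add \<phi>.hom_mult \<psi>.hom_mult)
qed

interpretation evaluation: ring_homomorphism "poly_eval c" for c :: "'v \<Rightarrow> 'a::comm_ring_1"
  unfolding poly_eval_def by (rule ring_homomorphism.poly_subst_hom[OF ring_homomorphism_id])

lemma poly_eval_Const: "poly_eval c (Const a) = a"
  unfolding poly_eval_def by (rule ring_homomorphism.poly_subst_Const[OF ring_homomorphism_id])

lemma poly_eval_Var: "poly_eval c (Var v) = c v"
  unfolding poly_eval_def by (rule ring_homomorphism.poly_subst_Var[OF ring_homomorphism_id])

text \<open>
  Collecting the powers of \<open>x\<close> makes the extension step, which speaks of univariate polynomials,
  applicable to multivariate ones.
\<close>

lemma mpolys_in_insert:
  assumes "p \<in> mpolys_in (insert x V)"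
  shows "\<exists>q\<in>polys_with_coeffs (mpolys_in V). p = poly q (Var x)"
proof -
  interpret A: subring "mpolys_in V" by (rule subring_mpolys_in)
  interpret AX: subring "polys_with_coeffs (mpolys_in V)" by (rule A.subring_polys_with_coeffs)
  have const: "\<exists>q\<in>polys_with_coeffs (mpolys_in V). p = poly q (Var x)" if "p \<in> mpolys_in V" for p
    using A.monom_in_polys_with_coeffs[OF that, of 0] by (intro bexI[of _ "[:p:]"]) (auto simp: monom_0)
  show ?thesis using assms
  proof induction
    case (Const c)
    then show ?case by (intro const mpolys_in.Const)
  next
    case (Var v)
    show ?case
    proof (cases "v = x")
      case True
      then show ?thesis using A.monom_in_polys_with_coeffs[OF A.one_closed, of 1]
        by (intro bexI[of _ "monom 1 1"]) (auto simp: poly_monom)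
    next
      case False
      then show ?thesis using Var by (intro const mpolys_in.Var) auto
    qed
  next
    case (add p q)
    then show ?case by (metis AX.add_closed poly_add)
  next
    case (mult p q)
    then show ?case by (metis AX.mult_closed poly_mult)
  qed
qed

text \<open>
  Changing the coordinate \<open>x\<close> of a point does not affect polynomials in the variables \<open>V\<close>, so the new
  evaluation is the extension of the old one that sends \<open>x\<close> to \<open>\<xi>\<close>.
\<close>

lemma poly_eval_update:
  assumes "x \<notin> V" "q \<in> polys_with_coeffs (mpolys_in V)"
  shows "poly_eval (c(x := \<xi>)) (poly q (Var x)) = poly (map_poly (poly_eval c) q) \<xi>"
proof -
  have *: "poly_eval (c(x := \<xi>)) a = poly_eval c a" if "a \<in> mpolys_in V" for a
    using assms(1) by (intro ring_homomorphisms_eq_on[OF evaluation.ring_homomorphism_axioms evaluation.ring_homomorphism_axioms that])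
      (auto simp: poly_eval_Const poly_eval_Var)
  have "map_poly (poly_eval (c(x := \<xi>))) q = map_poly (poly_eval c) q"
    using assms(2) by (intro poly_eqI) (simp add: evaluation.coeff_map_poly_hom * polys_with_coeffs_def)
  then show ?thesis by (simp add: evaluation.hom_poly poly_eval_Var)
qed

section \<open>The weak Nullstellensatz\<close>

text \<open>
  The element \<open>w\<close> is carried along for the induction: adding the variable \<open>x\<close> is guaranteed to work only at points
  where the obstruction \<open>u\<close> of the extension step does not vanish, and \<open>u\<close> is the element to which
  the induction hypothesis is applied.
\<close>

lemma prime_ideal_has_zero:
  fixes Q :: "('v, 'a::alg_closed_field) mpoly set"
  assumes "finite V" and Q: "prime_ideal Q" and "w \<in> mpolys_in V" "w \<notin> Q"
  shows "\<exists>c. (\<forall>q\<in>mpolys_in V \<inter> Q. poly_eval c q = 0) \<and> poly_eval c w \<noteq> 0"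
  using assms(1,3,4)
proof (induction V arbitrary: w rule: finite_induct)
  case empty
  have const: "\<exists>a. p = Const a" if "p \<in> mpolys_in {}" for p :: "('v, 'a) mpoly"
    using that
  proof induction
    case (add p q)
    then show ?case using ring_homomorphism.hom_add[OF ring_homomorphism_Const] by metis
  next
    case (mult p q)
    then show ?case using ring_homomorphism.hom_mult[OF ring_homomorphism_Const] by metis
  qed auto
  have sQ: "ideal.subspace Q" and "1 \<notin> Q" using Q by (auto simp: prime_ideal_def)
  have zero: "a = 0" if "Const a \<in> Q" for a
  proof (rule ccontr)
    assume "a \<noteq> 0"
    then have "Const (inverse a) * Const a = (1 :: ('v, 'a) mpoly)"
      by (simp add: Const_def mult_single single_one)
    then show False using ideal.subspace_scale[OF sQ that, of "Const (inverse a)"] \<open>1 \<notin> Q\<close> by simp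
  qed
  obtain a where a: "w = Const a" using const empty by blast
  have "a \<noteq> 0"
    using a empty(2) ideal.subspace_0[OF sQ] by (auto simp: Const_def)
  moreover have "poly_eval c q = 0" if "q \<in> mpolys_in {} \<inter> Q" for c q
    using const[of q] zero that by (auto simp: poly_eval_Const)
  ultimately show ?case by (auto simp: a poly_eval_Const)
next
  case (insert x V)
  interpret A: subring "mpolys_in V :: ('v, 'a) mpoly set" by (rule subring_mpolys_in)
  obtain v where v: "v \<in> polys_with_coeffs (mpolys_in V)" "w = poly v (Var x)"
    using mpolys_in_insert[OF insert.prems(1)] by blast
  then have "poly v (Var x) \<notin> Q" using insert.prems(2) by simp
  from A.extend_hom[OF Q v(1) this, where 'a = 'a]
  obtain u where "u \<in> mpolys_in V - Q" and ext: "\<forall>\<phi> :: ('v, 'a) mpoly \<Rightarrow> 'a.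
      ring_homomorphism \<phi> \<longrightarrow> \<phi> ` (mpolys_in V \<inter> Q) \<subseteq> {0} \<longrightarrow> \<phi> u \<noteq> 0 \<longrightarrow>
      extendable (mpolys_in V) Q (Var x) v \<phi>" by (rule bexE)
  then have u: "u \<in> mpolys_in V" "u \<notin> Q" by simp_all
  obtain c where c: "\<And>q. q \<in> mpolys_in V \<inter> Q \<Longrightarrow> poly_eval c q = 0" "poly_eval c u \<noteq> 0"
    using insert.IH[OF u] by blast
  have "extendable (mpolys_in V) Q (Var x) v (poly_eval c)"
    using ext evaluation.ring_homomorphism_axioms c(2) image_subsetI[of _ "poly_eval c" "{0}"] c(1)
    by (metis singletonI)
  then obtain \<xi> where \<xi>: "\<And>p. p \<in> polys_with_coeffs (mpolys_in V) \<Longrightarrow> poly p (Var x) \<in> Q \<Longrightarrow>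
      poly (map_poly (poly_eval c) p) \<xi> = 0" "poly (map_poly (poly_eval c) v) \<xi> \<noteq> 0"
    by (auto simp: extendable_def)
  show ?case
  proof (intro exI conjI ballI)
    show "poly_eval (c(x := \<xi>)) w \<noteq> 0"
      using \<xi>(2) v poly_eval_update[OF insert.hyps(2) v(1)] by simp
    fix q assume q: "q \<in> mpolys_in (insert x V) \<inter> Q"
    then obtain p where p: "p \<in> polys_with_coeffs (mpolys_in V)" "q = poly p (Var x)"
      using mpolys_in_insert[of q x V] by blast
    then show "poly_eval (c(x := \<xi>)) q = 0"
      using \<xi>(1)[OF p(1)] q poly_eval_update[OF insert.hyps(2) p(1)] by simp
  qed
qed

theorem weak_nullstellensatz:
  fixes F :: "('n::finite, 'a::alg_closed_field) mpoly set"
  assumes "zero_locus F = {}"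
  shows "1 \<in> ideal_generated F"
proof (rule ccontr)
  assume "1 \<notin> ideal_generated F"
  then obtain Q where Q: "prime_ideal Q" "ideal_generated F \<subseteq> Q"
    using prime_ideal_exists[OF ideal.subspace_span] by blast
  then have "1 \<notin> Q" by (simp add: prime_ideal_def)
  then obtain c where "\<And>q. q \<in> Q \<Longrightarrow> poly_eval c q = 0"
    using prime_ideal_has_zero[OF finite Q(1) mpolys_in_UNIV, of 1] mpolys_in_UNIV by blast
  then have "c \<in> zero_locus F"
    using Q(2) ideal.span_superset[of F] by (auto simp: zero_locus_def)
  with assms show False by simp
qed

section \<open>Leading monomials\<close>

context monomial_order
begin

text \<open>If \<open>u \<prec> 0\<close>, then multiplying by \<open>u\<close> decreases every monomial, against well-foundedness.\<close>

lemma zero_le: "0 \<preceq> u"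
proof (rule ccontr)
  assume "\<not> 0 \<preceq> u"
  then have "u \<preceq> 0" "u \<noteq> 0" by (auto simp: not_le order.strict_implies_order)
  then have descent: "u + w \<prec> w" for w
    using mult_mono[of u 0 w] by (simp add: less_le)
  have False for w :: "'v \<Rightarrow>\<^sub>0 nat"
  proof (induction w rule: less_induct)
    case (less w)
    show ?case by (rule less.IH[OF descent])
  qed
  then show False .
qed

lemma lead_monom_in_keys: "p \<noteq> 0 \<Longrightarrow> lead_monom p \<in> Poly_Mapping.keys p"
  unfolding lead_monom_def by (rule Max_in) simp_all

lemma le_lead_monom: "t \<in> Poly_Mapping.keys p \<Longrightarrow> t \<preceq> lead_monom p"
  unfolding lead_monom_def by (rule Max_ge) simp_all

text \<open>
  The polynomials all of whose monomials are divisible by one of the given leading monomials form an ideal.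
\<close>

lemma keys_in_lead_term_ideal:
  assumes "p \<in> ideal_generated (lead_term ` S)"
  shows "\<forall>t\<in>Poly_Mapping.keys p. \<exists>s\<in>S. \<exists>u. t = lead_monom s + u"
  using assms
proof (induction rule: ideal.span_induct)
  case base
  show ?case
  proof (rule ideal.subspaceI; clarify)
    fix p q t
    assume "\<forall>t\<in>Poly_Mapping.keys p. \<exists>s\<in>S. \<exists>u. t = lead_monom s + u"
      "\<forall>t\<in>Poly_Mapping.keys q. \<exists>s\<in>S. \<exists>u. t = lead_monom s + u"
      "t \<in> Poly_Mapping.keys (p + q)"
    then show "\<exists>s\<in>S. \<exists>u. t = lead_monom s + u"
      using Poly_Mapping.keys_add[of p q] by blast
  next
    fix c p t
    assume p: "\<forall>t\<in>Poly_Mapping.keys p. \<exists>s\<in>S. \<exists>u. t = lead_monom s + u"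
      and "t \<in> Poly_Mapping.keys (c * p)"
    then obtain a b where "t = a + b" "b \<in> Poly_Mapping.keys p"
      using keys_mult[of c p] by blast
    then show "\<exists>s\<in>S. \<exists>u. t = lead_monom s + u"
      using p by (metis add.left_commute)
  qed simp
next
  case (step p)
  then obtain s where "s \<in> S" "p = lead_term s" by blast
  then show ?case
    by (auto simp: lead_term_def split: if_splits intro!: bexI[of _ s] exI[of _ 0])
qed

lemma groebner_basis_lead_monom_dvd:
  assumes "groebner_basis G I" "p \<in> I" "p \<noteq> 0"
  obtains g u where "g \<in> G" "g \<noteq> 0" "lead_monom p = lead_monom g + u"
proof -
  have "lead_term p \<in> ideal_generated (lead_term ` (I - {0}))"
    using assms by (intro ideal.span_base) blast
  also have "\<dots> = ideal_generated (lead_term ` (G - {0}))"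
    using assms by (simp add: groebner_basis_def)
  finally have "\<forall>t\<in>Poly_Mapping.keys (lead_term p). \<exists>g\<in>G - {0}. \<exists>u. t = lead_monom g + u"
    by (rule keys_in_lead_term_ideal)
  moreover have "lead_monom p \<in> Poly_Mapping.keys (lead_term p)"
    using lead_monom_in_keys[OF assms(3)] by (simp add: lead_term_def in_keys_iff)
  ultimately show thesis using that by blast
qed

end

section \<open>The ideal generated by the polynomials y - z f\<close>

interpretation substitution: ring_homomorphism "poly_subst Const g" for g
  by (rule ring_homomorphism.poly_subst_hom[OF ring_homomorphism_Const])

interpretation embed: ring_homomorphism embed
  unfolding embed_def by (rule substitution.ring_homomorphism_axioms)

lemmas subst_Const = ring_homomorphism.poly_subst_Const[OF ring_homomorphism_Const]
  and subst_Var = ring_homomorphism.poly_subst_Var[OF ring_homomorphism_Const]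

lemma poly_subst_cong:
  assumes "\<And>t v. t \<in> Poly_Mapping.keys p \<Longrightarrow> v \<in> Poly_Mapping.keys t \<Longrightarrow> g v = h v"
  shows "poly_subst \<phi> g p = poly_subst \<phi> h p"
  unfolding poly_subst_def using assms by (intro sum.cong arg_cong2[of _ _ _ _ "(*)"] prod.cong) auto

lemma keys_mpolys_in:
  assumes "p \<in> mpolys_in V"
  shows "\<forall>t\<in>Poly_Mapping.keys p. Poly_Mapping.keys t \<subseteq> V"
  using assms
proof induction
  case (add p q)
  then show ?case using Poly_Mapping.keys_add[of p q] by blast
next
  case (mult p q)
  show ?case
  proof
    fix t assume "t \<in> Poly_Mapping.keys (p * q)"
    then obtain a b where "t = a + b" "a \<in> Poly_Mapping.keys p" "b \<in> Poly_Mapping.keys q"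
      using keys_mult[of p q] by blast
    then show "Poly_Mapping.keys t \<subseteq> V"
      using Poly_Mapping.keys_add[of a b] mult.IH by blast
  qed
qed (auto simp: Const_def Var_def split: if_splits)

lemma embed_in_mpolys_in: "embed q \<in> mpolys_in (range X)"
  using mpolys_in_UNIV[of q]
proof induction
  case (add p q)
  then show ?case by (simp add: embed.hom_add mpolys_in.add)
next
  case (mult p q)
  then show ?case by (simp add: embed.hom_mult mpolys_in.mult)
qed (auto simp: embed_def subst_Const subst_Var intro: mpolys_in.intros)

lemma subst_zf_embed: "poly_subst Const (subst_zf f) (embed q) = embed q"
  by (rule ring_homomorphisms_eq_on[OF ring_homomorphism_comp[OF embed.ring_homomorphism_axioms
        substitution.ring_homomorphism_axioms] embed.ring_homomorphism_axioms mpolys_in_UNIV])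
    (simp_all add: embed_def subst_Const subst_Var)

lemma subst_zf_ideal_hat:
  assumes "p \<in> ideal_hat f"
  shows "poly_subst Const (subst_zf f) p = 0"
  using assms unfolding ideal_hat_def
proof (induction rule: ideal.span_induct)
  case base
  show ?case
    by (rule ideal.subspaceI) (simp_all add: substitution.hom_zero substitution.hom_add substitution.hom_mult)
next
  case (step p)
  then show ?case
    by (auto simp: substitution.hom_diff substitution.hom_mult subst_Var subst_zf_embed)
qed

text \<open>
  If \<open>h = \<Sum> a\<^sub>i f\<^sub>i\<close>, then \<open>z h\<close> is congruent to \<open>\<Sum> a\<^sub>i y\<^sub>i\<close>, which is free of \<open>z\<close>. Asking only for some
  polynomial free of \<open>z\<close> makes the claim inductive over the generation of the ideal.
\<close>

lemma lift_to_ideal_hat: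
  fixes f :: "'k \<Rightarrow> ('n, 'a::comm_ring_1) mpoly"
  assumes "h \<in> ideal_generated (range f)"
  shows "\<exists>w\<in>mpolys_in (- {Z}). Var Z * embed h - w \<in> ideal_hat f"
  using assms
proof (induction rule: ideal.span_induct)
  case base
  have subspace: "ideal.subspace (ideal_hat f)"
    unfolding ideal_hat_def by (rule ideal.subspace_span)
  have "range X \<subseteq> - {Z}" by auto
  from subsetD[OF mpolys_in_mono[OF this] embed_in_mpolys_in]
  have embed: "embed q \<in> mpolys_in (- {Z})" for q :: "('n, 'a) mpoly" .
  show ?case
  proof (rule ideal.subspaceI; clarify)
    show "\<exists>w\<in>mpolys_in (- {Z}). Var Z * embed 0 - w \<in> ideal_hat f"
      using subring.zero_closed[OF subring_mpolys_in] ideal.subspace_0[OF subspace]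
      by (intro bexI[of _ 0]) (simp_all add: embed.hom_zero)
  next
    fix p q v w
    assume "v \<in> mpolys_in (- {Z})" "Var Z * embed p - v \<in> ideal_hat f"
      "w \<in> mpolys_in (- {Z})" "Var Z * embed q - w \<in> ideal_hat f"
    moreover from ideal.subspace_add[OF subspace this(2,4)]
    have "Var Z * embed (p + q) - (v + w) \<in> ideal_hat f"
      by (simp add: embed.hom_add algebra_simps)
    ultimately show "\<exists>w\<in>mpolys_in (- {Z}). Var Z * embed (p + q) - w \<in> ideal_hat f"
      using mpolys_in.add by blast
  next
    fix c p w
    assume "w \<in> mpolys_in (- {Z})" "Var Z * embed p - w \<in> ideal_hat f"
    moreover from ideal.subspace_scale[OF subspace this(2), of "embed c"]
    have "Var Z * embed (c * p) - embed c * w \<in> ideal_hat f"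
      by (simp add: embed.hom_mult algebra_simps)
    ultimately show "\<exists>w\<in>mpolys_in (- {Z}). Var Z * embed (c * p) - w \<in> ideal_hat f"
      using mpolys_in.mult embed by blast
  qed
next
  case (step h)
  then obtain i where i: "h = f i" by blast
  have "Var (Y i) - Var Z * embed (f i) \<in> ideal_hat f"
    unfolding ideal_hat_def by (rule ideal.span_base) simp
  then have "- (Var (Y i) - Var Z * embed (f i)) \<in> ideal_hat f"
    unfolding ideal_hat_def by (rule ideal.span_neg)
  then show ?case using mpolys_in.Var[of "Y i" "- {Z}"] by (auto simp: i)
qed

text \<open>
  Substituting \<open>y\<^sub>i = z f\<^sub>i\<close> and then \<open>z = 0\<close> has the same effect as substituting \<open>y\<^sub>i = 0\<close> and \<open>z = 0\<close>, and on
  the part \<open>q\<close> free of \<open>z\<close> also the same effect as \<open>y\<^sub>i = 0\<close> alone.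
\<close>

lemma subst_0_eq_of_vanishing:
  assumes zero: "poly_subst Const (subst_zf f) g = 0"
    and q: "g = Const c * Var Z + q" "\<And>t. t \<in> Poly_Mapping.keys q \<Longrightarrow> Poly_Mapping.lookup t Z = 0"
  shows "poly_subst Const subst_0 g = Const c * Var Z"
proof -
  define \<theta> where "\<theta> = (\<lambda>v. if v = Z then 0 else Var v :: (('a, 'b) var, 'c) mpoly)"
  define \<eta> where "\<eta> = (\<lambda>v. if v = Z then 0 else subst_0 v :: (('a, 'b) var, 'c) mpoly)"
  have "poly_subst Const \<eta> g = poly_subst Const \<theta> (poly_subst Const (subst_zf f) g)"
  proof (rule ring_homomorphisms_eq_on[OF substitution.ring_homomorphism_axioms
        ring_homomorphism_comp[OF substitution.ring_homomorphism_axioms substitution.ring_homomorphism_axioms]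
        mpolys_in_UNIV])
    show "poly_subst Const \<eta> (Var v) = poly_subst Const \<theta> (poly_subst Const (subst_zf f) (Var v))" for v
      by (cases v) (simp_all add: subst_Var substitution.hom_mult \<theta>_def \<eta>_def)
  qed (simp add: subst_Const)
  then have "poly_subst Const \<eta> g = 0" by (simp add: zero substitution.hom_zero)
  then have "poly_subst Const \<eta> q = 0"
    by (simp add: q(1) substitution.hom_add substitution.hom_mult subst_Var \<eta>_def)
  moreover have "poly_subst Const \<eta> q = poly_subst Const subst_0 q"
    by (rule poly_subst_cong) (auto simp: \<eta>_def in_keys_iff q(2))
  ultimately show ?thesis
    by (simp add: q(1) substitution.hom_add substitution.hom_mult subst_Var subst_Const)
qed

theorem theorem3p3:
  fixes f :: "'k::finite \<Rightarrow> ('n::finite, 'a::alg_closed_field) mpoly"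
    and le lt :: "(('n, 'k) var \<Rightarrow>\<^sub>0 nat) \<Rightarrow> (('n, 'k) var \<Rightarrow>\<^sub>0 nat) \<Rightarrow> bool"
    and G :: "(('n, 'k) var, 'a) mpoly set"
  assumes "monomial_order le lt"
    and "\<And>s t. Poly_Mapping.lookup s Z \<noteq> 0 \<Longrightarrow> Poly_Mapping.lookup t Z = 0 \<Longrightarrow> lt t s"
    and "monomial_order.groebner_basis le G (ideal_hat f)"
    and "zero_locus (range f) = {}"
  shows "\<exists>p\<in>G. extended_final_polynomial f p"
proof -
  interpret monomial_order le lt by fact
  let ?z = "Poly_Mapping.single Z 1 :: ('n, 'k) var \<Rightarrow>\<^sub>0 nat"
  obtain w where w: "w \<in> mpolys_in (- {Z})" "Var Z - w \<in> ideal_hat f"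
    using lift_to_ideal_hat[OF weak_nullstellensatz[OF assms(4)]] by (auto simp: embed.hom_one)
  have w_keys: "Poly_Mapping.lookup t Z = 0" if "t \<in> Poly_Mapping.keys w" for t
    using keys_mpolys_in[OF w(1)] that by (auto simp: in_keys_iff)
  define p where "p = Var Z - w"
  have z_key: "?z \<in> Poly_Mapping.keys p"
    using w_keys[of ?z] by (auto simp: p_def Var_def in_keys_iff lookup_minus)
  then have "p \<noteq> 0" by auto
  have lead_p: "lead_monom p = ?z"
  proof (rule ccontr)
    assume neq: "lead_monom p \<noteq> ?z"
    then have "lead_monom p \<in> Poly_Mapping.keys w"
      using lead_monom_in_keys[OF \<open>p \<noteq> 0\<close>]
      by (auto simp: p_def Var_def in_keys_iff lookup_minus lookup_single when_def split: if_splits)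
    then have "lt (lead_monom p) ?z" by (intro assms(2) w_keys) simp
    then show False using le_lead_monom[OF z_key] by (simp add: leD)
  qed
  obtain g u where g: "g \<in> G" "g \<noteq> 0" and zu: "?z = lead_monom g + u"
    using groebner_basis_lead_monom_dvd[OF assms(3) _ \<open>p \<noteq> 0\<close>] w(2) lead_p by (auto simp: p_def)
  have "g \<in> ideal_hat f" using assms(3) g(1) by (auto simp: groebner_basis_def)
  then have g0: "poly_subst Const (subst_zf f) g = 0" by (rule subst_zf_ideal_hat)
  have zu': "Poly_Mapping.lookup ?z v = Poly_Mapping.lookup (lead_monom g) v + Poly_Mapping.lookup u v" for v
    using zu by (metis lookup_add)
  \<comment> \<open>otherwise \<open>g\<close> is a nonzero constant, which the substitution \<open>y\<^sub>i = z f\<^sub>i\<close> does not annihilate\<close>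
  have lead_Z: "Poly_Mapping.lookup (lead_monom g) Z \<noteq> 0"
  proof
    assume "Poly_Mapping.lookup (lead_monom g) Z = 0"
    moreover have "Poly_Mapping.lookup (lead_monom g) v = 0" if "v \<noteq> Z" for v
      using zu'[of v] that by (simp add: lookup_single)
    ultimately have "lead_monom g = 0" by (metis poly_mapping_eqI lookup_zero)
    then have "t = 0" if "t \<in> Poly_Mapping.keys g" for t
      using le_lead_monom[OF that] zero_le[of t] by simp
    then have "g = Const (Poly_Mapping.lookup g 0)"
      by (intro poly_mapping_eqI) (auto simp: Const_def lookup_single when_def in_keys_iff)
    then have "g = 0" using g0 subst_Const[of "subst_zf f"] by metis
    then show False using g(2) by simp
  qed
  have lead_g: "lead_monom g = ?z"
  proof (rule poly_mapping_eqI)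
    show "Poly_Mapping.lookup (lead_monom g) v = Poly_Mapping.lookup ?z v" for v
      using zu'[of v] lead_Z by (cases "v = Z") (simp_all add: lookup_single)
  qed
  define c where "c = Poly_Mapping.lookup g ?z"
  have "c \<noteq> 0" using lead_monom_in_keys[OF g(2)] by (simp add: c_def lead_g in_keys_iff)
  define q where "q = g - Const c * Var Z"
  have q_single: "q = g - Poly_Mapping.single ?z c"
    by (simp add: q_def Const_def Var_def mult_single)
  have "Poly_Mapping.lookup t Z = 0" if "t \<in> Poly_Mapping.keys q" for t
  proof (rule ccontr)
    assume "Poly_Mapping.lookup t Z \<noteq> 0"
    then have t: "t = (t - ?z) + ?z"
      by (intro poly_mapping_eqI) (auto simp: lookup_add lookup_minus lookup_single when_def)
    have "le ?z t" using mult_mono[OF zero_le[of "t - ?z"], of ?z] t by simp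
    moreover have "t \<noteq> ?z" "t \<in> Poly_Mapping.keys g"
      using that by (auto simp: q_single c_def in_keys_iff lookup_minus lookup_single when_def split: if_splits)
    then have "le t ?z" using le_lead_monom lead_g by metis
    ultimately show False using \<open>t \<noteq> ?z\<close> by simp
  qed
  then have "poly_subst Const subst_0 g = Const c * Var Z"
    by (intro subst_0_eq_of_vanishing[OF g0, of c q]) (simp_all add: q_def)
  then show ?thesis
    using g(1) g0 \<open>c \<noteq> 0\<close> by (auto simp: extended_final_polynomial_def)
qed

end
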